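(* Let $\mathbb{F}$ be an NRC field of characteristic $2$. Then: (a) $\mathrm{S}_2(\mathbb{F})$ is weakly triangularizable if and only if every separable polynomial of degree $2$ over $\mathbb{F}$ splits over $\mathbb{F}$. (b) $\mathrm{S}_3(\mathbb{F})$ is not weakly triangularizable, and consequently $\mathrm{S}_n(\mathbb{F})$ is not weakly triangularizable for every integer $n>2$.
   Context: A field $\mathbb{F}$ is NRC when the map $x\in\mathbb{F}\mapsto x^2\in\mathbb{F}$ is nonsurjective. $\mathrm{S}_n(\mathbb{F})$ is the space of symmetric $n\times n$ matrices over $\mathbb{F}$. A linear space of $n\times n$ matrices over $\mathbb{F}$ is weakly triangularizable when all its elements are triangularizable over $\mathbb{F}$ (similar over $\mathbb{F}$ to an upper-triangular matrix). *)

theory Defs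
  imports "HOL-Algebra.Algebraic_Closure_Type" "Jordan_Normal_Form.Matrix"
begin

text \<open>
  Fields are rendered as types of class \<^class>\<open>field\<close>; matrices are the matrices of
  variable dimension from the entry Jordan-Normal-Form, so that the size can be quantified over.
\<close>

definition symmetric_mats :: "nat \<Rightarrow> 'a mat set" where
  "symmetric_mats n = {A \<in> carrier_mat n n. transpose_mat A = A}"

definition triangularizable :: "'a :: field mat \<Rightarrow> bool" where
  "triangularizable A \<longleftrightarrow> (\<exists>T. similar_mat A T \<and> upper_triangular T)"

definition weakly_triangularizable :: "'a :: field mat set \<Rightarrow> bool" where
  "weakly_triangularizable V \<longleftrightarrow> (\<forall>A\<in>V. triangularizable A)"

text \<open>
  A polynomial is separable if it has only simple roots in an algebraic closure; here
  \<^const>\<open>rsquarefree\<close> says that a polynomial is nonzero and all its roots have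
  multiplicity one. The weaker convention (every irreducible factor has only simple roots)
  differs in degree 2 only for scalar multiples of squares of linear polynomials, and those split.
\<close>

definition separable :: "'a :: field poly \<Rightarrow> bool" where
  "separable p \<longleftrightarrow> rsquarefree (map_poly to_ac p)"

definition splits :: "'a :: field poly \<Rightarrow> bool" where
  "splits p \<longleftrightarrow> (\<exists>c as. p = smult c (\<Prod>a\<leftarrow>as. [:- a, 1:]))"

end

theory Submission
  imports Defs "Jordan_Normal_Form.Char_Poly"
begin

text \<open>
  In characteristic 2 a quadratic polynomial is separable exactly when its linear coefficient is
  nonzero (\<open>separable_degree_2_iff\<close>), because the square of \<open>X - r\<close> is \<open>X\<^sup>2 + r\<^sup>2\<close>.
  For a \<open>2 \<times> 2\<close> matrix that coefficient is, up to sign, the trace.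

  Part (a). A symmetric \<open>2 \<times> 2\<close> matrix of nonzero trace has a separable characteristic polynomial;
  one of trace zero has diagonal entries \<open>a, a\<close> and hence, with off-diagonal entry \<open>b\<close>,
  characteristic polynomial \<open>X\<^sup>2 + a\<^sup>2 + b\<^sup>2 = (X - (a + b))\<^sup>2\<close>, which always splits. In size 2 one root
  of the characteristic polynomial is enough for triangularizability (\<open>triangularizable_2x2\<close>).
  Conversely, every polynomial \<open>X\<^sup>2 + u X + v\<close> with \<open>u \<noteq> 0\<close> is the characteristic polynomial of the
  symmetric matrix with rows \<open>(w, w)\<close> and \<open>(w, u + w)\<close>, where \<open>w = v / u\<close>.

  Part (b). Let \<open>d\<close> be a nonsquare. From size 3 on, symmetric matrices can also have an inseparable
  quadratic factor in their characteristic polynomial: that of the symmetric matrix with rows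
  \<open>(d, 0, d)\<close>, \<open>(0, 1, 1)\<close>, \<open>(d, 1, d + 1)\<close> is \<open>X (X\<^sup>2 + d)\<close> (\<open>char_poly_symmetric_3x3\<close>), and zero
  blocks carry the factor to every larger size. As \<open>X\<^sup>2 + d\<close> has no root, this characteristic
  polynomial is not a product of linear factors, as it would be for a triangularizable matrix.
\<close>

section \<open>Quadratic polynomials in characteristic two\<close>

lemma two_eq_0_CHAR_2: "CHAR('a :: comm_ring_1) = 2 \<Longrightarrow> (2 :: 'a) = 0"
  by (metis of_nat_CHAR of_nat_numeral)

lemma add_eq_0_iff_CHAR_2: "CHAR('a :: comm_ring_1) = 2 \<Longrightarrow> (x :: 'a) + y = 0 \<longleftrightarrow> x = y"
  by (metis eq_iff_diff_eq_0 minus_CHAR_2)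

lemma degree_2_poly_eq:
  assumes "degree p = 2"
  shows "p = [:coeff p 0, coeff p 1, coeff p 2:]"
proof (rule poly_eqI)
  fix n
  show "coeff p n = coeff [:coeff p 0, coeff p 1, coeff p 2:] n"
  proof (cases "n > 2")
    case True
    then show ?thesis
      using assms by (auto simp: coeff_eq_0 coeff_pCons split: nat.split)
  next
    case False
    then have "n = 0 \<or> n = 1 \<or> n = 2" by auto
    then show ?thesis by (auto simp: numeral_2_eq_2)
  qed
qed

text \<open>
  If the linear coefficient vanishes, any root \<open>r\<close> in the algebraic closure is double, since
  \<open>c X\<^sup>2 + e = c (X - r)\<^sup>2\<close>. A double root in turn forces this shape, hence a vanishing linear
  coefficient.
\<close>

lemma separable_degree_2_iff:
  assumes char_two: "CHAR('a :: field) = 2"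
    and deg: "degree (p :: 'a poly) = 2"
  shows "separable p \<longleftrightarrow> coeff p 1 \<noteq> 0"
proof -
  define q where "q = map_poly to_ac p"
  have char_two': "CHAR('a alg_closure) = 2"
    using char_two by simp
  have "coeff p 2 \<noteq> 0"
    using deg by (metis leading_coeff_0_iff degree_0 zero_neq_numeral)
  then have deg_q: "degree q = 2"
    unfolding q_def using deg by (subst map_poly_degree_eq) simp_all
  have q0: "q \<noteq> 0"
    using deg_q by auto
  have coeff_q: "coeff q i = to_ac (coeff p i)" for i
    unfolding q_def by (simp add: coeff_map_poly)
  have square: "[:- r, 1:] ^ 2 = [:r ^ 2, 0, 1:]" for r :: "'a alg_closure"
    by (simp add: power2_eq_square uminus_CHAR_2[OF char_two'] two_eq_0_CHAR_2[OF char_two'])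
  show ?thesis
  proof
    assume sep: "separable p"
    show "coeff p 1 \<noteq> 0"
    proof
      assume lin: "coeff p 1 = 0"
      obtain r where r: "poly q r = 0"
        using alg_closed_imp_poly_has_root[of q] deg_q by auto
      obtain e c where q_eq: "q = [:e, 0, c:]"
        using degree_2_poly_eq[OF deg_q] lin by (metis coeff_q to_ac_0)
      have "e + c * r ^ 2 = 0"
        using r unfolding q_eq by (simp add: power2_eq_square ac_simps)
      then have "q = smult c ([:- r, 1:] ^ 2)"
        unfolding square q_eq by (simp add: add_eq_0_iff_CHAR_2[OF char_two'])
      then have "[:- r, 1:] ^ 2 dvd q"
        by (metis dvd_smult dvd_refl)
      then have "order r q \<ge> 2"
        using q0 by (subst (asm) order_divides) auto
      moreover have "order r q \<le> 1"
        using sep unfolding separable_def rsquarefree_def q_def[symmetric]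
        by (metis le_numeral_extra(4) zero_le_one)
      ultimately show False by simp
    qed
  next
    assume lin: "coeff p 1 \<noteq> 0"
    have "order r q \<le> 1" for r
    proof (rule ccontr)
      assume "\<not> order r q \<le> 1"
      then have "[:- r, 1:] ^ 2 dvd q"
        by (subst order_divides) auto
      then obtain k where k: "q = [:- r, 1:] ^ 2 * k" ..
      have "degree q = 2 + degree k"
        using q0 unfolding k by (subst degree_mult_eq) (auto simp: degree_power_eq)
      then obtain c where "k = [:c:]"
        using deg_q degree_eq_zeroE by (metis add_cancel_right_right)
      then have "coeff q 1 = 0"
        unfolding k square by simp
      then show False
        using lin by (simp add: coeff_q)
    qed
    then show "separable p"
      unfolding separable_def rsquarefree_def q_def[symmetric]
      using q0 by (metis le_antisym less_one linorder_not_less)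
  qed
qed

lemma splits_degree_2_root:
  assumes deg: "degree p = 2" and "splits p"
  obtains r where "poly p r = 0"
proof -
  obtain c as where p: "p = smult c (\<Prod>a\<leftarrow>as. [:- a, 1:])"
    using assms(2) unfolding splits_def by blast
  show thesis
  proof (cases as)
    case Nil
    then show ?thesis using p deg by simp
  next
    case (Cons a as')
    then have "poly p a = 0" using p by simp
    then show ?thesis by (rule that)
  qed
qed

section \<open>Characteristic polynomials\<close>

lemma triangularizable_char_poly:
  assumes "triangularizable A"
  obtains as where "char_poly A = (\<Prod>a\<leftarrow>as. [:- a, 1:])"
proof -
  obtain T where sim: "similar_mat A T" and T: "upper_triangular T"
    using assms unfolding triangularizable_def by blast
  obtain n where "T \<in> carrier_mat n n"
    using similar_matD[OF sim] by auto
  then show thesis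
    using that char_poly_upper_triangular[OF _ T] char_poly_similar[OF sim] by metis
qed

text \<open>
  If the root \<open>a\<close> of the product is not a root of \<open>q\<close>, then it is a root of the cofactor,
  and \<open>X - a\<close> can be cancelled.
\<close>

lemma dvd_prod_linear_has_root:
  fixes q :: "'a :: field poly"
  assumes "q dvd (\<Prod>a\<leftarrow>as. [:- a, 1:])" and "degree q > 0"
  obtains r where "poly q r = 0"
proof -
  have "\<exists>r. poly q r = 0"
    using assms(1)
  proof (induction as)
    case Nil
    then have "is_unit q" by simp
    then show ?case using assms(2) by (simp add: is_unit_iff_degree poly_dvd_1)
  next
    case (Cons a as)
    show ?case
    proof (rule ccontr)
      assume no_root: "\<not> ?case"
      obtain k where k: "[:- a, 1:] * (\<Prod>a\<leftarrow>as. [:- a, 1:]) = q * k"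
        using Cons.prems by (auto elim!: dvdE simp del: mult_pCons_left)
      have "poly (q * k) a = 0"
        unfolding k[symmetric] by simp
      then have "poly k a = 0"
        using no_root by simp
      then obtain k' where "k = [:- a, 1:] * k'"
        by (auto simp: poly_eq_0_iff_dvd)
      then have "[:- a, 1:] * (\<Prod>a\<leftarrow>as. [:- a, 1:]) = [:- a, 1:] * (q * k')"
        using k by (simp only: ac_simps)
      then have "(\<Prod>a\<leftarrow>as. [:- a, 1:]) = q * k'"
        by (subst (asm) mult_cancel_left) simp
      then show False
        using Cons.IH no_root by auto
    qed
  qed
  then show thesis using that by blast
qed

lemma det_2x2:
  assumes A: "(A :: 'a :: comm_ring_1 mat) \<in> carrier_mat 2 2"
  shows "det A = A $$ (0,0) * A $$ (1,1) - A $$ (0,1) * A $$ (1,0)"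
  using A
  by (subst laplace_expansion_row[OF A, of 0])
     (auto simp: cofactor_def mat_delete_def det_single numeral_2_eq_2)

lemma det_3x3:
  assumes A: "(A :: 'a :: comm_ring_1 mat) \<in> carrier_mat 3 3"
  shows "det A = A $$ (0,0) * (A $$ (1,1) * A $$ (2,2) - A $$ (1,2) * A $$ (2,1))
               - A $$ (0,1) * (A $$ (1,0) * A $$ (2,2) - A $$ (1,2) * A $$ (2,0))
               + A $$ (0,2) * (A $$ (1,0) * A $$ (2,1) - A $$ (1,1) * A $$ (2,0))"
proof -
  have "mat_delete A 0 j \<in> carrier_mat 2 2" for j
    using A by (auto simp: mat_delete_def)
  then show ?thesis
    using A
    by (subst laplace_expansion_row[OF A, of 0])
       (auto simp: cofactor_def mat_delete_def det_2x2 numeral_3_eq_3 numeral_2_eq_2 algebra_simps)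
qed

lemma char_poly_2x2:
  fixes a b c d :: "'a :: field"
  shows "char_poly (mat_of_rows_list 2 [[a, b], [c, d]]) = [:a * d - b * c, - (a + d), 1:]"
  unfolding char_poly_def
  by (subst det_2x2)
     (auto simp: char_poly_matrix_def mat_of_rows_list_def numeral_2_eq_2 algebra_simps)

lemma mat_2x2_eq:
  assumes "A \<in> carrier_mat 2 2"
  shows "A = mat_of_rows_list 2 [[A $$ (0,0), A $$ (0,1)], [A $$ (1,0), A $$ (1,1)]]"
  using assms by (intro eq_matI) (auto simp: mat_of_rows_list_def less_Suc_eq numeral_2_eq_2)

lemma mult_mat_2x2:
  fixes a b c d :: "'a :: comm_ring_1"
  shows "mat_of_rows_list 2 [[a, b], [c, d]] * mat_of_rows_list 2 [[a', b'], [c', d']] =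
    mat_of_rows_list 2 [[a * a' + b * c', a * b' + b * d'], [c * a' + d * c', c * b' + d * d']]"
  by (intro eq_matI)
     (auto simp: mat_of_rows_list_def scalar_prod_def less_Suc_eq numeral_2_eq_2)

lemma one_mat_2x2: "1\<^sub>m 2 = mat_of_rows_list 2 [[1, 0], [0, 1 :: 'a :: comm_ring_1]]"
  by (intro eq_matI) (auto simp: mat_of_rows_list_def less_Suc_eq numeral_2_eq_2)

lemma triangularizable_2x2:
  fixes a b c d r :: "'a :: field"
  assumes root: "poly (char_poly (mat_of_rows_list 2 [[a, b], [c, d]])) r = 0"
  shows "triangularizable (mat_of_rows_list 2 [[a, b], [c, d]])"
    (is "triangularizable ?A")
proof (cases "c = 0")
  case True
  then have "upper_triangular ?A"
    by (auto simp: upper_triangular_def mat_of_rows_list_def less_Suc_eq numeral_2_eq_2)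
  moreover have "similar_mat ?A ?A"
    by (rule similar_mat_refl[of _ 2]) (simp add: mat_of_rows_list_def numeral_2_eq_2)
  ultimately show ?thesis
    unfolding triangularizable_def by blast
next
  case False
  (* The first column of ?P is an eigenvector for r; the second is the first unit vector,
     whose image (a, c) is that eigenvector plus (a + d - r) times the unit vector. *)
  let ?T = "mat_of_rows_list 2 [[r, 1], [0, a + d - r]]"
  let ?P = "mat_of_rows_list 2 [[r - d, 1], [c, 0]]"
  let ?Q = "mat_of_rows_list 2 [[0, 1 / c], [1, (d - r) / c]]"
  have eq: "(a - r) * (d - r) = b * c"
    using root by (simp add: char_poly_2x2 algebra_simps)
  have "similar_mat ?A ?T"
  proof (rule similar_matI)
    show "{?A, ?T, ?P, ?Q} \<subseteq> carrier_mat 2 2"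
      by (auto simp: mat_of_rows_list_def numeral_2_eq_2)
    show "?P * ?Q = 1\<^sub>m 2" "?Q * ?P = 1\<^sub>m 2"
      using False by (simp_all add: mult_mat_2x2 one_mat_2x2 field_simps)
    have "r * (r - d) + a * (d - r) = b * c"
      using eq by (simp add: algebra_simps)
    then have "b = (r * (r - d) + a * (d - r)) / c"
      using False by (metis nonzero_mult_div_cancel_right)
    then have b: "b = r * (r - d) / c + a * ((d - r) / c)"
      by (simp only: add_divide_distrib times_divide_eq_right)
    have "?P * ?T = mat_of_rows_list 2 [[r * (r - d), a], [c * r, c]]"
      by (simp add: mult_mat_2x2 algebra_simps)
    then show "?A = ?P * ?T * ?Q"
      using False by (simp add: mult_mat_2x2 b)
  qed
  moreover have "upper_triangular ?T"
    by (auto simp: upper_triangular_def mat_of_rows_list_def less_Suc_eq numeral_2_eq_2)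
  ultimately show ?thesis
    unfolding triangularizable_def by blast
qed

section \<open>Symmetric matrices of size two\<close>

lemma weakly_triangularizable_symmetric_2_iff:
  assumes char_two: "CHAR('a :: field) = 2"
  shows "weakly_triangularizable (symmetric_mats 2 :: 'a mat set)
    \<longleftrightarrow> (\<forall>p :: 'a poly. degree p = 2 \<and> separable p \<longrightarrow> splits p)"
proof
  assume wt: "weakly_triangularizable (symmetric_mats 2 :: 'a mat set)"
  show "\<forall>p :: 'a poly. degree p = 2 \<and> separable p \<longrightarrow> splits p"
  proof (intro allI impI, elim conjE)
    fix p :: "'a poly"
    assume deg: "degree p = 2" and "separable p"
    then have lin: "coeff p 1 \<noteq> 0"
      using separable_degree_2_iff[OF char_two] by blast
    (* A multiple of p is X^2 + u X + u w; for the matrix below the w^2 terms of the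
       determinant cancel and leave u w. *)
    define l u w where "l = coeff p 2" and "u = coeff p 1 / l" and "w = coeff p 0 / coeff p 1"
    have l: "l \<noteq> 0"
      using deg unfolding l_def by (metis leading_coeff_0_iff degree_0 zero_neq_numeral)
    let ?A = "mat_of_rows_list 2 [[w, w], [w, u + w]]"
    have "?A \<in> symmetric_mats 2"
      unfolding symmetric_mats_def
      by (auto intro!: eq_matI simp: mat_of_rows_list_def less_Suc_eq numeral_2_eq_2)
    then have tri: "triangularizable ?A"
      using wt unfolding weakly_triangularizable_def by blast
    have "char_poly ?A = [:u * w, u, 1:]"
      unfolding char_poly_2x2
      using two_eq_0_CHAR_2[OF char_two] uminus_CHAR_2[OF char_two, of u]
      by (simp add: algebra_simps)
    moreover have "p = smult l [:u * w, u, 1:]"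
      using l lin degree_2_poly_eq[OF deg] unfolding u_def w_def
      by (simp add: l_def)
    ultimately have p: "p = smult l (char_poly ?A)" by simp
    obtain as where "char_poly ?A = (\<Prod>a\<leftarrow>as. [:- a, 1:])"
      using triangularizable_char_poly[OF tri] .
    then show "splits p"
      using p unfolding splits_def by metis
  qed
next
  assume sp: "\<forall>p :: 'a poly. degree p = 2 \<and> separable p \<longrightarrow> splits p"
  show "weakly_triangularizable (symmetric_mats 2 :: 'a mat set)"
    unfolding weakly_triangularizable_def
  proof
    fix A :: "'a mat"
    assume A: "A \<in> symmetric_mats 2"
    define a b d where "a = A $$ (0,0)" and "b = A $$ (0,1)" and "d = A $$ (1,1)"
    have carrier: "A \<in> carrier_mat 2 2" and sym: "transpose_mat A = A"
      using A unfolding symmetric_mats_def by auto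
    have "A $$ (1,0) = transpose_mat A $$ (1,0)"
      by (simp add: sym)
    also have "\<dots> = b"
      using carrier by (simp add: b_def)
    finally have A_eq: "A = mat_of_rows_list 2 [[a, b], [b, d]]"
      using mat_2x2_eq[OF carrier] by (simp add: a_def b_def d_def)
    have "\<exists>r. poly (char_poly A) r = 0"
    proof (cases "a + d = 0")
      case True
      then have "d = a"
        by (simp add: add_eq_0_iff_CHAR_2[OF char_two])
      then have "poly (char_poly A) (a + b) = 0"
        unfolding A_eq char_poly_2x2 by (simp add: algebra_simps)
      then show ?thesis ..
    next
      case False
      let ?p = "char_poly A"
      have p: "?p = [:a * d - b * b, a + d, 1:]"
        unfolding A_eq char_poly_2x2 uminus_CHAR_2[OF char_two] ..
      have "degree ?p = 2" "coeff ?p 1 \<noteq> 0"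
        using False unfolding p by simp_all
      then show ?thesis
        using sp separable_degree_2_iff[OF char_two, of ?p] splits_degree_2_root by metis
    qed
    then show "triangularizable A"
      using triangularizable_2x2 unfolding A_eq by blast
  qed
qed

section \<open>Symmetric matrices of larger size\<close>

text \<open>
  The matrix is found as follows. For a symmetric matrix with diagonal \<open>(a, b, a + b)\<close>, the trace
  is zero and the coefficient of \<open>X\<close> is \<open>a b\<close> plus a square. Taking \<open>a = d\<close>, \<open>b = 1\<close> makes it a
  nonsquare when \<open>d\<close> is one, whatever the off-diagonal entries; these are then chosen to make the
  determinant vanish and the coefficient exactly \<open>d\<close>.
\<close>

lemma char_poly_symmetric_3x3:
  fixes d :: "'a :: field"
  assumes char_two: "CHAR('a) = 2"
  shows "char_poly (mat_of_rows_list 3 [[d, 0, d], [0, 1, 1], [d, 1, d + 1]])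
    = [:0, 1:] * [:d, 0, 1:]"
  unfolding char_poly_def
proof (subst det_3x3, goal_cases)
  case 1
  show ?case
    by (auto simp: char_poly_matrix_def mat_of_rows_list_def)
next
  case 2
  show ?case
    by (simp add: char_poly_matrix_def mat_of_rows_list_def numeral_3_eq_3 numeral_2_eq_2)
       (simp add: two_eq_0_CHAR_2[OF char_two])
qed

lemma symmetric_mat_with_quadratic_factor:
  fixes d :: "'a :: field"
  assumes char_two: "CHAR('a) = 2" and "n \<ge> 3"
  shows "\<exists>A \<in> symmetric_mats n. [:d, 0, 1:] dvd char_poly A"
  using \<open>n \<ge> 3\<close>
proof (induction n rule: dec_induct)
  case base
  let ?A = "mat_of_rows_list 3 [[d, 0, d], [0, 1, 1], [d, 1, d + 1]]"
  have "?A \<in> symmetric_mats 3"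
    unfolding symmetric_mats_def
    by (auto intro!: eq_matI simp: mat_of_rows_list_def less_Suc_eq numeral_3_eq_3)
  moreover have "[:d, 0, 1:] dvd char_poly ?A"
    unfolding char_poly_symmetric_3x3[OF char_two] by (rule dvd_triv_right)
  ultimately show ?case by blast
next
  case (step n)
  then obtain A where A: "A \<in> symmetric_mats n" "[:d, 0, 1:] dvd char_poly A" by blast
  then have carrier: "A \<in> carrier_mat n n" and sym: "transpose_mat A = A"
    unfolding symmetric_mats_def by auto
  let ?B = "four_block_mat (0\<^sub>m 1 1) (0\<^sub>m 1 n) (0\<^sub>m n 1) A"
  have "?B \<in> symmetric_mats (Suc n)"
    using carrier sym four_block_carrier_mat[of "0\<^sub>m 1 1" 1 1 A n n]
    unfolding symmetric_mats_def by (simp add: transpose_four_block_mat[of _ 1 1 _ n _ n])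
  moreover have "[:d, 0, 1:] dvd char_poly ?B"
    using A(2) carrier
    by (subst char_poly_four_block_zeros_col[of _ _ n]) auto
  ultimately show ?case by blast
qed

lemma not_weakly_triangularizable_symmetric:
  assumes char_two: "CHAR('a :: field) = 2"
    and NRC: "\<not> surj (\<lambda>x :: 'a. x ^ 2)"
    and n: "n \<ge> 3"
  shows "\<not> weakly_triangularizable (symmetric_mats n :: 'a mat set)"
proof
  assume wt: "weakly_triangularizable (symmetric_mats n :: 'a mat set)"
  obtain d :: 'a where d: "\<And>x. d \<noteq> x ^ 2"
    using NRC unfolding surj_def by blast
  obtain A where A: "A \<in> symmetric_mats n" "[:d, 0, 1:] dvd char_poly A"
    using symmetric_mat_with_quadratic_factor[OF char_two n] by blast
  then have "triangularizable A"
    using wt unfolding weakly_triangularizable_def by blast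
  then obtain as where "char_poly A = (\<Prod>a\<leftarrow>as. [:- a, 1:])"
    by (rule triangularizable_char_poly)
  then obtain r where "poly [:d, 0, 1:] r = 0"
    using A(2) dvd_prod_linear_has_root[of "[:d, 0, 1:]" as] by auto
  then have "d + r ^ 2 = 0"
    by (simp add: power2_eq_square)
  then have "d = r ^ 2"
    by (simp add: add_eq_0_iff_CHAR_2[OF char_two])
  with d show False by blast
qed

theorem theoremB1:
  assumes char_two: "CHAR('a :: field) = 2"
    and NRC: "\<not> surj (\<lambda>x :: 'a. x ^ 2)"
  shows "(weakly_triangularizable (symmetric_mats 2 :: 'a mat set)
            \<longleftrightarrow> (\<forall>p :: 'a poly. degree p = 2 \<and> separable p \<longrightarrow> splits p))
       \<and> \<not> weakly_triangularizable (symmetric_mats 3 :: 'a mat set)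
       \<and> (\<forall>n > 2. \<not> weakly_triangularizable (symmetric_mats n :: 'a mat set))"
  using weakly_triangularizable_symmetric_2_iff[OF char_two]
    not_weakly_triangularizable_symmetric[OF char_two NRC]
  by auto

end
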